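(* Let $\mathbf{s}_1,\dots,\mathbf{s}_M\in\mathbb{R}^n$ be a constellation (or code) and let $i\neq j$. The pairwise error probability $\Pr\{\mathbf{s}_i\to\mathbf{s}_j\}$ of the maximum likelihood detector in the AWGN channel is a convex function of the noise power $\sigma_0^2$, for any $n$, in the small noise/high SNR mode $$\left(n+2+\sqrt{2(n+2)}\right)\sigma_0^2\le d_{\min,i}^2$$ and in the large noise/low SNR mode $$\left(n+2-\sqrt{2(n+2)}\right)\sigma_0^2\ge (d_{ij}+d_{\max,j})^2,$$ and it has an even number of inflection points in-between.
   Context: Channel: $\mathbf{r}=\mathbf{s}+\boldsymbol{\xi}$, where $\mathbf{s}\in\{\mathbf{s}_1,\dots,\mathbf{s}_M\}\subset\mathbb{R}^n$ is the transmitted point and $\boldsymbol{\xi}\sim\mathcal{N}(\mathbf{0},\sigma_0^2\mathbf{I})$ has density $p_\xi(\mathbf{x})=(2\pi\sigma_0^2)^{-n/2}e^{-|\mathbf{x}|^2/(2\sigma_0^2)}$, with $|\cdot|$ the Euclidean norm; the noise power $\sigma_0^2$ is the noise variance per dimension. The constellation is normalized by $\frac1M\sum_{k=1}^M|\mathbf{s}_k|^2=1$ (so the SNR is $1/\sigma_0^2$); it is fixed while $\sigma_0^2$ varies. Codewords of a code under maximum likelihood decoding are regarded as points of a constellation, so codes are included. The maximum likelihood (minimum distance) detector outputs $\hat{\mathbf{s}}=\arg\min_{\mathbf{s}_k}|\mathbf{r}-\mathbf{s}_k|$. The decision region of $\mathbf{s}_k$ is its Voronoi cell $V_k=\{\mathbf{r}\in\mathbb{R}^n: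 |\mathbf{r}-\mathbf{s}_k|\le|\mathbf{r}-\mathbf{s}_l|\ \forall l\}$. The pairwise error probability is $$\Pr\{\mathbf{s}_i\to\mathbf{s}_j\}=\Pr[\hat{\mathbf{s}}=\mathbf{s}_j\mid\mathbf{s}=\mathbf{s}_i]=\int_{V_j-\mathbf{s}_i}p_\xi(\mathbf{x})\,d\mathbf{x}.$$ Notation: $d_{\min,i}$ is the minimum distance from $\mathbf{s}_i$ to the boundary of its decision region (equal to $\min_{k\ne i}\frac12|\mathbf{s}_k-\mathbf{s}_i|$); $d_{\max,j}$ is the maximum distance from $\mathbf{s}_j$ to the boundary of its decision region; $d_{ij}=|\mathbf{s}_i-\mathbf{s}_j|$. Inflection points are points where the second derivative (here in $\sigma_0^2$) is zero; "in-between" refers to the values of $\sigma_0^2$ between the small noise and large noise modes.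
   Formalization: Inflection points are counted with multiplicity as zeros of the second derivative (distinct zeros can be odd in number); d_max,j is infinite for unbounded cells, also when n=1, where the large noise claim fails; such cells have no large noise mode and no in-between; points are distinct. *)

theory Defs
  imports "HOL-Analysis.Analysis"
begin

text \<open>
  A constellation is an injective map \<open>s\<close> from a finite index type into
  \<open>real ^ 'n\<close>; the dimension is \<open>CARD('n)\<close>. The real variable \<open>P\<close>
  is the noise power, i.e. the noise variance per dimension.
\<close>

definition noise_density :: "real \<Rightarrow> real ^ 'n \<Rightarrow> real" where
  "noise_density P x =
     (2 * pi * P) powr (- real CARD('n) / 2) * exp (- (norm x)\<^sup>2 / (2 * P))"

definition voronoi :: "('m \<Rightarrow> real ^ 'n) \<Rightarrow> 'm \<Rightarrow> (real ^ 'n) set" where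
  "voronoi s k = {r. \<forall>l. norm (r - s k) \<le> norm (r - s l)}"

text \<open>Points at equal distance from several \<open>s k\<close> form a null set, so the way the
  detector breaks ties does not matter.\<close>

definition pairwise_error_prob ::
    "('m \<Rightarrow> real ^ 'n) \<Rightarrow> 'm \<Rightarrow> 'm \<Rightarrow> real \<Rightarrow> real" where
  "pairwise_error_prob s i j P =
     (LINT x : (\<lambda>r. r - s i) ` voronoi s j | lborel. noise_density P x)"

definition d_min :: "('m \<Rightarrow> real ^ 'n) \<Rightarrow> 'm \<Rightarrow> real" where
  "d_min s i = infdist (s i) (frontier (voronoi s i))"

text \<open>
  The maximal distance to the boundary is infinite for an unbounded cell. In dimension
  at least 2 the supremum gives this by itself. In dimension 1 the boundary of a half-line
  is a single point, and the case distinction is needed: for two points on the line the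
  error probability is concave, not convex, at large noise power.
\<close>

definition d_max :: "('m \<Rightarrow> real ^ 'n) \<Rightarrow> 'm \<Rightarrow> ereal" where
  "d_max s j =
     (if bounded (voronoi s j)
      then (SUP x \<in> frontier (voronoi s j). ereal (dist (s j) x))
      else \<infinity>)"

definition small_noise_mode :: "('m \<Rightarrow> real ^ 'n) \<Rightarrow> 'm \<Rightarrow> real set" where
  "small_noise_mode s i =
     {P. 0 < P \<and>
         (real CARD('n) + 2 + sqrt (2 * (real CARD('n) + 2))) * P \<le> (d_min s i)\<^sup>2}"

definition large_noise_mode :: "('m \<Rightarrow> real ^ 'n) \<Rightarrow> 'm \<Rightarrow> 'm \<Rightarrow> real set" where
  "large_noise_mode s i j =
     {P. 0 < P \<and>
         ereal ((real CARD('n) + 2 - sqrt (2 * (real CARD('n) + 2))) * P)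
           \<ge> (ereal (norm (s i - s j)) + d_max s j)\<^sup>2}"

text \<open>If the cell of \<open>s j\<close> is unbounded, there is no large noise mode and hence
  nothing in between.\<close>

definition between_modes :: "('m \<Rightarrow> real ^ 'n) \<Rightarrow> 'm \<Rightarrow> 'm \<Rightarrow> real set" where
  "between_modes s i j =
     {P. (\<exists>a \<in> small_noise_mode s i. \<exists>b \<in> large_noise_mode s i j. a < P \<and> P < b)
         \<and> P \<notin> small_noise_mode s i \<and> P \<notin> large_noise_mode s i j}"

definition inflection_points :: "(real \<Rightarrow> real) \<Rightarrow> real set \<Rightarrow> real set" where
  "inflection_points f A = {P \<in> A. (deriv ^^ 2) f P = 0}"

text \<open>
  Inflection points are counted with their multiplicity as zeros of the second
  derivative. The number of distinct zeros may be odd: for some cells the second derivative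
  touches zero without changing sign, and such a point accounts for two zeros.
\<close>

definition inflection_multiplicity :: "(real \<Rightarrow> real) \<Rightarrow> real \<Rightarrow> nat" where
  "inflection_multiplicity f P = (LEAST m. (deriv ^^ (2 + m)) f P \<noteq> 0)"

end

theory Submission
  imports
    Defs
    "HOL-Complex_Analysis.Conformal_Mappings"
    "HOL-Probability.Distributions"
begin

text \<open>
  The second derivative in \<open>P\<close> of the noise density at \<open>x\<close> is a positive multiple of
  \<open>q(P, r) = r\<^sup>2 - 2 (n + 2) P r + n (n + 2) P\<^sup>2\<close> with \<open>r = |x|\<^sup>2\<close>, whose roots in \<open>r\<close> are
  \<open>(n + 2 \<plusminus> sqrt (2 (n + 2))) P\<close>. In the small noise mode all points of the shifted cell lie beyond
  the larger root, in the large noise mode all lie below the smaller one; so the density is convex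
  in \<open>P\<close> pointwise, and integration preserves this.

  If there is anything in between, the cell is bounded, and then the error probability extends
  holomorphically to the right half plane. Its second derivative is strictly positive at both end
  points, since \<open>q\<close> vanishes only on two spheres. A real analytic function with equal signs at the
  end points of an interval has an even number of zeros there, counted with multiplicity.
\<close>

section \<open>Zeros of real analytic functions\<close>

text \<open>Dividing \<open>f\<close> by the product of the \<open>(x - z) ^ m z\<close> leaves a continuous function without
  zeros, of constant sign by the intermediate value theorem; so the product has the same sign at
  \<open>a\<close> and \<open>b\<close>, and at \<open>a\<close> its sign is \<open>(-1)\<close> to the sum of the multiplicities.\<close>

lemma even_sum_multiplicity:
  fixes f :: "real \<Rightarrow> real" and m :: "real \<Rightarrow> nat"
  assumes "a \<le> b" and Z: "Z = {x \<in> {a..b}. f x = 0}" "finite Z"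
    and cont: "\<And>x. x \<in> {a..b} \<Longrightarrow> isCont f x"
    and factor: "\<And>z. z \<in> Z \<Longrightarrow>
      \<exists>g. isCont g z \<and> g z \<noteq> 0 \<and> (\<forall>\<^sub>F x in nhds z. f x = (x - z) ^ m z * g x)"
    and sign: "0 < f a * f b"
  shows "even (\<Sum>z\<in>Z. m z)"
proof -
  obtain G where G: "\<And>z. z \<in> Z \<Longrightarrow> isCont (G z) z" "\<And>z. z \<in> Z \<Longrightarrow> G z z \<noteq> 0"
    "\<And>z. z \<in> Z \<Longrightarrow> \<forall>\<^sub>F x in nhds z. f x = (x - z) ^ m z * G z x"
    using factor by metis
  define p where "p = (\<lambda>A x. \<Prod>w\<in>A. (x - w :: real) ^ m w)"
  \<comment> \<open>On \<open>Z\<close> the quotient of \<open>f\<close> by the product is 0 / 0;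
    the local cofactor \<open>G x\<close> supplies the value that makes \<open>q\<close> continuous
    there.\<close>
  define q where "q = (\<lambda>x. if x \<in> Z then G x x / p (Z - {x}) x else f x / p Z x)"
  have p_nz: "p A x \<noteq> 0" if "x \<notin> A" "A \<subseteq> Z" for A x
  proof -
    have "finite A" using that(2) \<open>finite Z\<close> by (rule finite_subset)
    with that(1) show ?thesis by (auto simp: p_def)
  qed
  have p_cont: "isCont (p A) x" for A x
    unfolding p_def by (intro continuous_intros)
  have q_cont: "isCont q x" if x: "x \<in> {a..b}" for x
  proof (cases "x \<in> Z")
    case True
    have "\<forall>\<^sub>F y in nhds x. y \<notin> Z - {x}"
    proof -
      have "open (- (Z - {x}))" using \<open>finite Z\<close> by (intro open_Compl finite_imp_closed) simp
      from eventually_nhds_in_open[OF this, of x] show ?thesis by (simp add: disj_commute imp_conv_disj)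
    qed
    then have "\<forall>\<^sub>F y in nhds x. q y = G x y / p (Z - {x}) y"
      using G(3)[OF True]
    proof eventually_elim
      case (elim y)
      show ?case
      proof (cases "y = x")
        case False
        have "p Z y = (y - x) ^ m x * p (Z - {x}) y"
          unfolding p_def using True \<open>finite Z\<close> by (simp add: prod.remove)
        with elim False show ?thesis by (simp add: q_def)
      qed (simp add: q_def True)
    qed
    then have "isCont q x \<longleftrightarrow> isCont (\<lambda>y. G x y / p (Z - {x}) y) x"
      by (intro isCont_cong)
    also have "\<dots>"
      using G(1)[OF True] p_cont p_nz[of x "Z - {x}"] by (intro continuous_intros) auto
    finally show ?thesis .
  next
    case False
    have "\<forall>\<^sub>F y in nhds x. y \<notin> Z"
      using eventually_nhds_in_open[of "- Z" x] \<open>finite Z\<close> False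
      by (simp add: open_Compl finite_imp_closed)
    then have "\<forall>\<^sub>F y in nhds x. q y = f y / p Z y"
      by eventually_elim (simp add: q_def)
    then have "isCont q x \<longleftrightarrow> isCont (\<lambda>y. f y / p Z y) x"
      by (intro isCont_cong)
    also have "\<dots>"
      using cont[OF x] p_cont p_nz[of x Z] False by (intro continuous_intros) auto
    finally show ?thesis .
  qed
  have q_nz: "q x \<noteq> 0" if "x \<in> {a..b}" for x
    using that G(2)[of x] p_nz[of x "Z - {x}"] p_nz[of x Z] by (auto simp: q_def Z(1))
  have "0 < q a * q b"
  proof (rule ccontr)
    assume "\<not> ?thesis"
    then have "(q a \<le> 0 \<and> 0 \<le> q b) \<or> (q b \<le> 0 \<and> 0 \<le> q a)"
      by (auto simp: not_less mult_le_0_iff)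
    then obtain x where "a \<le> x" "x \<le> b" "q x = 0"
      using IVT[of q a 0 b] IVT2[of q b 0 a] q_cont \<open>a \<le> b\<close> by auto
    with q_nz show False by auto
  qed
  moreover have ab: "a \<notin> Z" "b \<notin> Z" using sign by (auto simp: Z(1))
  then have "f a * f b = (p Z a * p Z b) * (q a * q b)"
    using p_nz[of a Z] p_nz[of b Z] by (simp add: q_def)
  ultimately have pos: "0 < p Z a * p Z b"
    using sign by (metis zero_less_mult_pos2)
  have "0 < p Z b"
    unfolding p_def using ab(2) by (intro prod_pos zero_less_power) (auto simp: Z(1) less_le)
  with pos have "0 < p Z a" by (simp add: zero_less_mult_iff)
  moreover have "p Z a = (-1) ^ (\<Sum>z\<in>Z. m z) * (\<Prod>z\<in>Z. (z - a) ^ m z)"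
    by (simp add: p_def power_sum power_mult_distrib[symmetric] flip: prod.distrib)
  moreover have "0 < (\<Prod>z\<in>Z. (z - a) ^ m z)"
    using ab(1) by (intro prod_pos zero_less_power) (auto simp: Z(1) less_le)
  ultimately show ?thesis
    by (cases "even (\<Sum>z\<in>Z. m z)") (auto simp: zero_less_mult_iff)
qed

text \<open>A complex derivative can be computed along the real axis, where \<open>H\<close> takes
  real values: the real part of the derivative is that of \<open>f\<close>, and the imaginary part
  is the derivative of zero.\<close>

lemma deriv_holomorphic_extension:
  fixes f :: "real \<Rightarrow> real"
  assumes "H holomorphic_on S" "open S" "open U" "of_real ` U \<subseteq> S"
    and ext: "\<And>x. x \<in> U \<Longrightarrow> H (of_real x) = of_real (f x)" and x: "x \<in> U"
  shows "(f has_real_derivative deriv f x) (at x)"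
    and "deriv H (of_real x) = of_real (deriv f x)"
proof -
  have "(H has_field_derivative deriv H (of_real x)) (at (of_real x))"
    using assms by (intro holomorphic_derivI) auto
  then have D: "((\<lambda>x. H (of_real x)) has_vector_derivative deriv H (of_real x)) (at x)"
    by (rule has_vector_derivative_real_field)
  have D': "((\<lambda>x. of_real (f x)) has_vector_derivative deriv H (of_real x)) (at x)"
    by (rule has_vector_derivative_transform_within_open[OF D \<open>open U\<close> x]) (simp add: ext)
  have "((\<lambda>x. Re (of_real (f x))) has_vector_derivative Re (deriv H (of_real x))) (at x)"
    by (rule bounded_linear.has_vector_derivative[OF bounded_linear_Re D'])
  then have re: "(f has_real_derivative Re (deriv H (of_real x))) (at x)"
    by (simp add: has_real_derivative_iff_has_vector_derivative)
  have "((\<lambda>x. Im (of_real (f x))) has_vector_derivative Im (deriv H (of_real x))) (at x)"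
    by (rule bounded_linear.has_vector_derivative[OF bounded_linear_Im D'])
  then have "((\<lambda>_. 0) has_vector_derivative Im (deriv H (of_real x))) (at x)" by simp
  from vector_derivative_unique_at[OF this has_vector_derivative_const]
  have "Im (deriv H (of_real x)) = 0" .
  then show "(f has_real_derivative deriv f x) (at x)"
    "deriv H (of_real x) = of_real (deriv f x)"
    using DERIV_imp_deriv[OF re] re by (auto simp: complex_eq_iff)
qed

lemma higher_deriv_holomorphic_extension:
  fixes f :: "real \<Rightarrow> real"
  assumes H: "H holomorphic_on S" "open S" "open U" "of_real ` U \<subseteq> S"
    and ext: "\<And>x. x \<in> U \<Longrightarrow> H (of_real x) = of_real (f x)" and x: "x \<in> U"
  shows "(deriv ^^ k) H (of_real x) = of_real ((deriv ^^ k) f x)"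
  using x
proof (induction k arbitrary: x)
  case (Suc k)
  have "(deriv ^^ k) H holomorphic_on S" using H by (intro holomorphic_higher_deriv)
  from deriv_holomorphic_extension(2)[OF this H(2-4) Suc.IH Suc.prems] show ?case by simp
qed (simp add: ext)

text \<open>The holomorphic extension provides what the elementary parity lemma asks for: isolated
  zeros make \<open>Z\<close> finite by compactness, and the factorization of \<open>H\<close> at a
  zero restricts to a real factorization whose exponent is the vanishing order. That
  \<open>H\<close> is nonzero at \<open>a\<close> rules out the zero function.\<close>

lemma even_sum_vanishing_order:
  fixes f :: "real \<Rightarrow> real"
  assumes H: "H holomorphic_on S" "open S" "connected S" "open U" "of_real ` U \<subseteq> S"
    and ext: "\<And>x. x \<in> U \<Longrightarrow> H (of_real x) = of_real (f x)"
    and ab: "a \<le> b" "{a..b} \<subseteq> U" and pos: "0 < f a * f b"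
  defines "Z \<equiv> {x \<in> {a..b}. f x = 0}"
  shows "finite Z" "even (\<Sum>x\<in>Z. LEAST m. (deriv ^^ m) f x \<noteq> 0)"
proof -
  define m where "m = (\<lambda>x. LEAST m. (deriv ^^ m) f x \<noteq> 0)"
  have US: "of_real x \<in> S" if "x \<in> U" for x using that H(5) by blast
  have aS: "of_real a \<in> S" using ab by (intro US) auto
  have Ha: "H (of_real a) \<noteq> 0" using ext[of a] ab pos by auto
  have derivs: "(deriv ^^ k) H (of_real x) = of_real ((deriv ^^ k) f x)" if "x \<in> U" for x k
    using higher_deriv_holomorphic_extension[OF H(1,2,4,5) ext that] .
  show "finite Z"
  proof (cases "Z = {}")
    case False
    then obtain z where z: "z \<in> {a..b}" "f z = 0" by (auto simp: Z_def)
    have "\<not> H constant_on S"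
    proof
      assume "H constant_on S"
      then obtain c where c: "\<And>w. w \<in> S \<Longrightarrow> H w = c" by (auto simp: constant_on_def)
      have "of_real z \<in> S" "H (of_real z) = 0" using z ab(2) US ext[of z] by auto
      with c[of "of_real z"] c[OF aS] Ha show False by simp
    qed
    moreover have "compact (of_real ` {a..b} :: complex set)"
      by (intro compact_continuous_image continuous_intros) auto
    ultimately have fin: "finite {w \<in> of_real ` {a..b}. H w = 0}"
      using holomorphic_compact_finite_zeros[OF H(1-3)] H(5) ab(2) by blast
    have "of_real ` Z \<subseteq> {w \<in> of_real ` {a..b}. H w = 0}"
      using ext ab(2) by (auto simp: Z_def)
    then have "finite (of_real ` Z :: complex set)" using fin by (rule finite_subset)
    then show ?thesis by (rule finite_imageD) (auto simp: inj_on_def)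
  qed auto
  moreover have "isCont f x" if "x \<in> {a..b}" for x
    using deriv_holomorphic_extension(1)[OF H(1,2,4,5) ext, of x] that ab(2) DERIV_isCont
    by blast
  moreover have "\<exists>g. isCont g z \<and> g z \<noteq> 0 \<and> (\<forall>\<^sub>F x in nhds z. f x = (x - z) ^ m z * g x)"
    if "z \<in> Z" for z
  proof -
    have z: "z \<in> U" "f z = 0" "of_real z \<in> S" using that ab(2) US by (auto simp: Z_def)
    \<comment> \<open>If all derivatives vanished at \<open>z\<close>, the identity theorem would
      make \<open>H\<close> zero on the connected set \<open>S\<close>, hence at \<open>a\<close>.
      So the \<open>LEAST\<close> in \<open>m\<close> is attained.\<close>
    have "\<exists>k. (deriv ^^ k) f z \<noteq> 0"
    proof (rule ccontr)
      assume "\<nexists>k. (deriv ^^ k) f z \<noteq> 0"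
      then have "\<And>k. (deriv ^^ k) H (of_real z) = 0" using derivs[OF z(1)] by simp
      then have "H (of_real a) = 0"
        by (rule holomorphic_fun_eq_0_on_connected[OF H(1-3) _ z(3) aS])
      with Ha show False by simp
    qed
    then have m_nz: "(deriv ^^ m z) f z \<noteq> 0" unfolding m_def by (rule LeastI_ex)
    have m_min: "(deriv ^^ k) f z = 0" if "k < m z" for k
      using not_less_Least[OF that[unfolded m_def]] by simp
    have m0: "0 < m z" using m_nz z(2) by (cases "m z") auto
    have dnz: "(deriv ^^ m z) H (of_real z) \<noteq> 0" using derivs[OF z(1)] m_nz by simp
    have dz: "(deriv ^^ k) H (of_real z) = 0" if "0 < k" "k < m z" for k
      using derivs[OF z(1)] m_min[OF that(2)] by simp
    obtain g r where g: "0 < r" "g holomorphic_on ball (of_real z) r"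
      "\<And>w. w \<in> ball (of_real z) r \<Longrightarrow> H w - H (of_real z) = (w - of_real z) ^ m z * g w"
      "\<And>w. w \<in> ball (of_real z) r \<Longrightarrow> g w \<noteq> 0"
      by (rule holomorphic_factor_order_of_zero[OF H(1,2) z(3) m0 dnz dz], assumption, assumption, rule that)
    have near: "\<forall>\<^sub>F x in nhds z. x \<in> U \<inter> ball z r"
      using H(4) z(1) g(1) by (intro eventually_nhds_in_open) auto
    have eq: "of_real (f x) = of_real ((x - z) ^ m z) * g (of_real x)" if "x \<in> U \<inter> ball z r" for x
    proof -
      have "dist (of_real z) (of_real x :: complex) < r"
        using that by (simp add: dist_norm flip: of_real_diff)
      then show ?thesis
        using that ext[of x] ext[OF z(1)] z(2) g(3)[of "of_real x"] by simp
    qed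
    have gc: "isCont (\<lambda>x. g (of_real x)) z"
    proof (rule continuous_within_compose3[where g=g])
      show "isCont g (of_real z)"
        using holomorphic_on_imp_continuous_on[OF g(2)] g(1)
        by (simp add: continuous_on_eq_continuous_at)
    qed (intro continuous_intros)
    show ?thesis
    proof (intro exI conjI)
      show "isCont (\<lambda>x. Re (g (of_real x))) z" using gc unfolding isCont_def by (rule tendsto_Re)
      show "\<forall>\<^sub>F x in nhds z. f x = (x - z) ^ m z * Re (g (of_real x))"
        using near
      proof eventually_elim
        case (elim x)
        from arg_cong[OF eq[OF elim], of Re] show ?case by simp
      qed
      \<comment> \<open>The factorization shows that \<open>g\<close> is real at real points near
        \<open>z\<close>, except at \<open>z\<close> itself, where \<open>(x - z) ^ m z\<close>
        cannot be cancelled. Continuity carries this over to \<open>z\<close>, so that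
        \<open>g z\<close> being nonzero forces its real part to be nonzero.\<close>
      have "((\<lambda>x. Im (g (of_real x))) \<longlongrightarrow> Im (g (of_real z))) (at z)"
        using gc by (auto simp: isCont_def intro: tendsto_Im)
      moreover have "((\<lambda>x. Im (g (of_real x))) \<longlongrightarrow> 0) (at z)"
      proof (rule tendsto_eventually)
        have "\<forall>\<^sub>F x in at z. x \<in> U \<inter> ball z r"
          using near by (simp add: eventually_nhds_conv_at)
        moreover have "\<forall>\<^sub>F x in at z. x \<noteq> z" by (simp add: eventually_at_filter)
        ultimately show "\<forall>\<^sub>F x in at z. Im (g (of_real x)) = 0"
        proof eventually_elim
          case (elim x)
          from arg_cong[OF eq[OF elim(1)], of Im] elim(2) show ?case by simp
        qed
      qed
      ultimately have "Im (g (of_real z)) = 0" by (rule tendsto_unique[rotated]) simp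
      moreover have "g (of_real z) \<noteq> 0" using g by simp
      ultimately show "Re (g (of_real z)) \<noteq> 0" by (simp add: complex_eq_iff)
    qed
  qed
  ultimately show "even (\<Sum>x\<in>Z. LEAST m. (deriv ^^ m) f x \<noteq> 0)"
    using even_sum_multiplicity[OF ab(1) _ _ _ _ pos, of Z m] unfolding m_def Z_def by blast
qed

section \<open>Exponential integrals\<close>

lemma norm_exp_of_real_mult_le:
  fixes y :: "'b::{real_normed_field,banach}"
  assumes "\<bar>r\<bar> \<le> R"
  shows "norm (exp (y * of_real r)) \<le> exp (norm y * R)"
proof -
  have "norm (exp (y * of_real r)) \<le> exp (norm (y * of_real r))"
    by (rule norm_exp)
  also have "\<dots> \<le> exp (norm y * R)"
    using assms by (simp add: norm_mult mult_left_mono)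
  finally show ?thesis .
qed

text \<open>The bound on \<open>\<phi>\<close> is required only where the weight is nonzero. This
  admits the unbounded exponent \<open>- (norm x)\<^sup>2\<close> when the weight is supported on a
  bounded set.\<close>

lemma integrable_mult_exp:
  fixes y :: "'b::{real_normed_field,banach,second_countable_topology}"
  assumes w: "integrable M w" and [measurable]: "\<phi> \<in> borel_measurable M"
    and R: "\<And>x. w x \<noteq> 0 \<Longrightarrow> \<bar>\<phi> x\<bar> \<le> R"
  shows "integrable M (\<lambda>x. of_real (w x) * exp (y * of_real (\<phi> x)))"
proof -
  have [measurable]: "w \<in> borel_measurable M" using w by auto
  show ?thesis
  proof (rule Bochner_Integration.integrable_bound)
    show "integrable M (\<lambda>x. exp (norm y * R) * w x)" using w by simp
    show "AE x in M. norm (of_real (w x) * exp (y * of_real (\<phi> x))) \<le> norm (exp (norm y * R) * w x)"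
    proof (intro AE_I2)
      fix x
      show "norm (of_real (w x) * exp (y * of_real (\<phi> x))) \<le> norm (exp (norm y * R) * w x)"
        using norm_exp_of_real_mult_le[OF R, of x y] mult_left_mono[of _ _ "\<bar>w x\<bar>"]
        by (cases "w x = 0") (simp_all add: norm_mult abs_mult mult_ac)
    qed
  qed measurable
qed

text \<open>Differentiation under the integral sign, by the estimate |exp u - 1 - u| \<le> exp |u| *
  |u|^2 with u = h * \<phi> x: integrated, it bounds the remainder of the difference by a multiple
  of |h|^2. The field is left general so that the real derivatives and the complex extension come
  from the same argument.\<close>

lemma has_field_derivative_integral_exp:
  fixes z :: "'b::{real_normed_field,banach,second_countable_topology}"
  assumes w: "integrable M w" and [measurable]: "\<phi> \<in> borel_measurable M"
    and R: "\<And>x. w x \<noteq> 0 \<Longrightarrow> \<bar>\<phi> x\<bar> \<le> R"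
  shows "((\<lambda>z. \<integral>x. of_real (w x) * exp (z * of_real (\<phi> x)) \<partial>M) has_field_derivative
           (\<integral>x. of_real (w x * \<phi> x) * exp (z * of_real (\<phi> x)) \<partial>M)) (at z)"
    (is "(?G has_field_derivative ?D) _")
proof -
  have [measurable]: "w \<in> borel_measurable M" using w by auto
  note exp_le = norm_exp_of_real_mult_le[OF R]
  have int0: "integrable M (\<lambda>x. of_real (w x) * exp (y * of_real (\<phi> x)))" for y :: 'b
    by (rule integrable_mult_exp[OF assms])
  have int1: "integrable M (\<lambda>x. of_real (w x * \<phi> x) * exp (z * of_real (\<phi> x)))"
  proof (rule Bochner_Integration.integrable_bound)
    show "integrable M (\<lambda>x. (R * exp (norm z * R)) * w x)" using w by simp
    show "AE x in M. norm (of_real (w x * \<phi> x) * exp (z * of_real (\<phi> x)))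
        \<le> norm ((R * exp (norm z * R)) * w x)"
    proof (intro AE_I2)
      fix x
      show "norm (of_real (w x * \<phi> x) * exp (z * of_real (\<phi> x))) \<le> norm ((R * exp (norm z * R)) * w x)"
      proof (cases "w x = 0")
        case False
        have "\<bar>\<phi> x\<bar> * norm (exp (z * of_real (\<phi> x))) \<le> \<bar>R\<bar> * exp (norm z * R)"
          using R[OF False] exp_le[OF False, of z] by (intro mult_mono) auto
        then have "\<bar>w x\<bar> * (\<bar>\<phi> x\<bar> * norm (exp (z * of_real (\<phi> x)))) \<le> \<bar>w x\<bar> * (\<bar>R\<bar> * exp (norm z * R))"
          by (rule mult_left_mono) simp
        then show ?thesis by (simp add: norm_mult abs_mult mult_ac)
      qed simp
    qed
  qed measurable
  define K where "K = (\<integral>x. \<bar>w x\<bar> * (exp (norm z * R) * (exp R * R\<^sup>2)) \<partial>M)"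
  have bound: "norm (?G (z + h) - ?G z - h * ?D) \<le> K * (norm h)\<^sup>2" if h: "norm h \<le> 1" for h
  proof -
    \<comment> \<open>The integrand of the remainder, with the Taylor remainder of the exponential
      split off as a factor.\<close>
    let ?E = "\<lambda>x. of_real (w x) * exp (z * of_real (\<phi> x)) *
      (exp (h * of_real (\<phi> x)) - (1 + h * of_real (\<phi> x)))"
    have E: "?E = (\<lambda>x. of_real (w x) * exp ((z + h) * of_real (\<phi> x))
          - of_real (w x) * exp (z * of_real (\<phi> x))
          - h * (of_real (w x * \<phi> x) * exp (z * of_real (\<phi> x))))"
      by (simp add: fun_eq_iff algebra_simps exp_add)
    have int_E: "integrable M ?E"
      unfolding E using int0 int1 by (intro Bochner_Integration.integrable_diff integrable_mult_right)
    have eq: "?G (z + h) - ?G z - h * ?D = integral\<^sup>L M ?E"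
      unfolding E Bochner_Integration.integral_diff[OF Bochner_Integration.integrable_diff[OF
            int0[of "z + h"] int0[of z]] integrable_mult_right[OF int1]]
        Bochner_Integration.integral_diff[OF int0[of "z + h"] int0[of z]]
      by (simp only: integral_mult_right_zero)
    have "norm (?G (z + h) - ?G z - h * ?D) \<le>
      (\<integral>x. \<bar>w x\<bar> * (exp (norm z * R) * (exp R * R\<^sup>2)) * (norm h)\<^sup>2 \<partial>M)"
      unfolding eq
    proof (rule order_trans[OF integral_norm_bound], rule Bochner_Integration.integral_mono)
      show "integrable M (\<lambda>x. norm (?E x))" using int_E by (rule integrable_norm)
      show "integrable M (\<lambda>x. \<bar>w x\<bar> * (exp (norm z * R) * (exp R * R\<^sup>2)) * (norm h)\<^sup>2)"
        using w by simp
      fix x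
      show "norm (of_real (w x) * exp (z * of_real (\<phi> x)) *
          (exp (h * of_real (\<phi> x)) - (1 + h * of_real (\<phi> x))))
        \<le> \<bar>w x\<bar> * (exp (norm z * R) * (exp R * R\<^sup>2)) * (norm h)\<^sup>2"
      proof (cases "w x = 0")
        case False
        let ?y = "h * of_real (\<phi> x)"
        have le: "norm ?y \<le> norm h * R" using R[OF False] by (simp add: norm_mult mult_left_mono)
        have "0 \<le> R" using R[OF False] by simp
        then have le1: "norm ?y \<le> R" using le h mult_right_mono[of "norm h" 1 R] by simp
        have "norm (exp ?y - (1 + ?y)) \<le> exp (norm ?y) * (norm ?y)\<^sup>2"
          using Taylor_exp_field[of ?y 1] by (simp add: power2_eq_square)
        also have "\<dots> \<le> exp R * (norm h * R)\<^sup>2"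
          using le le1 by (intro mult_mono power_mono) auto
        finally have "norm (exp (z * of_real (\<phi> x))) * norm (exp ?y - (1 + ?y))
            \<le> exp (norm z * R) * (exp R * (norm h * R)\<^sup>2)"
          using exp_le[OF False] by (intro mult_mono) auto
        then have "\<bar>w x\<bar> * (norm (exp (z * of_real (\<phi> x))) * norm (exp ?y - (1 + ?y)))
            \<le> \<bar>w x\<bar> * (exp (norm z * R) * (exp R * (norm h * R)\<^sup>2))"
          by (rule mult_left_mono) simp
        then show ?thesis by (simp add: norm_mult power_mult_distrib mult_ac)
      qed simp
    qed
    then show ?thesis by (simp add: K_def)
  qed
  have "((\<lambda>h. (?G (z + h) - ?G z) / h) \<longlongrightarrow> ?D) (at 0)"
  proof (rule LIM_zero_cancel, rule Lim_null_comparison)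
    have "\<forall>\<^sub>F h :: 'b in at 0. norm h < 1 \<and> h \<noteq> 0"
      by (auto simp: eventually_at intro!: exI[of _ 1])
    then show "\<forall>\<^sub>F h in at 0. norm ((?G (z + h) - ?G z) / h - ?D) \<le> K * norm h"
    proof eventually_elim
      case (elim h)
      have "(?G (z + h) - ?G z) / h - ?D = (?G (z + h) - ?G z - h * ?D) / h"
        using elim by (simp add: field_simps)
      then have "norm ((?G (z + h) - ?G z) / h - ?D) = norm (?G (z + h) - ?G z - h * ?D) / norm h"
        by (simp add: norm_divide)
      also have "\<dots> \<le> K * norm h"
        using bound[of h] elim by (simp add: divide_le_eq power2_eq_square mult_ac)
      finally show ?case .
    qed
    show "((\<lambda>h. K * norm h) \<longlongrightarrow> 0) (at 0)"
      by (rule tendsto_eq_intros refl | simp)+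
  qed
  then show ?thesis by (simp add: DERIV_def)
qed

text \<open>The integrand is a product over the coordinates, so its integral is a product of
  one-dimensional ones, each finite by comparison with the normal density of standard deviation
  \<open>sqrt P\<close>.\<close>

lemma integrable_gaussian:
  assumes "0 < P"
  shows "integrable lborel (\<lambda>x::'a::euclidean_space. exp (- (norm x)\<^sup>2 / (2 * P)))"
proof (rule integrableI_bounded)
  have "exp (- (norm x)\<^sup>2 / (2 * P)) = (\<Prod>b\<in>Basis. exp (- (x \<bullet> b)\<^sup>2 / (2 * P)))" for x :: 'a
    unfolding power2_norm_eq_inner euclidean_inner[of x x]
    by (simp add: exp_sum[symmetric] sum_divide_distrib sum_negf power2_eq_square)
  then have "(\<integral>\<^sup>+x. ennreal (norm (exp (- (norm (x::'a))\<^sup>2 / (2 * P)))) \<partial>lborel)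
      = (\<integral>\<^sup>+x. (\<Prod>b\<in>Basis. ennreal (exp (- ((x::'a) \<bullet> b)\<^sup>2 / (2 * P)))) \<partial>lborel)"
    by (simp add: prod_ennreal abs_prod)
  also have "\<dots> = (\<Prod>b\<in>(Basis :: 'a set). \<integral>\<^sup>+x. ennreal (exp (- x\<^sup>2 / (2 * P))) \<partial>lborel)"
    by (subst nn_integral_lborel_prod) auto
  also have "\<dots> < \<infinity>"
  proof -
    have "integrable lborel (\<lambda>x. sqrt (2 * pi * P) * normal_density 0 (sqrt P) x)"
      using assms by (intro integrable_mult_right integrable_normal_density) simp
    then have "integrable lborel (\<lambda>x. exp (- x\<^sup>2 / (2 * P)))"
      using assms by (simp add: normal_density_def)
    from integrableD(2)[OF this] have "(\<integral>\<^sup>+x. ennreal (exp (- x\<^sup>2 / (2 * P))) \<partial>lborel) < \<infinity>"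
      by (simp add: less_top)
    then show ?thesis by (simp add: power_less_top_ennreal)
  qed
  finally show "(\<integral>\<^sup>+x. ennreal (norm (exp (- (norm (x::'a))\<^sup>2 / (2 * P)))) \<partial>lborel) < \<infinity>" .
qed measurable

section \<open>The Gaussian mass of a set as a function of the noise power\<close>

text \<open>The functions \<open>J0\<close>, \<open>J1\<close>, \<open>J2\<close> are kept abstract
  because the computation serves twice: for the density at a fixed point, and for its integral over
  a bounded set.\<close>

lemma powr_mult_has_second_derivative:
  fixes J0 J1 J2 :: "real \<Rightarrow> real" and n :: real
  assumes J0: "\<And>t. 0 < t \<Longrightarrow> (J0 has_real_derivative J1 t) (at t)"
    and J1: "\<And>t. 0 < t \<Longrightarrow> (J1 has_real_derivative J2 t) (at t)"
    and P: "0 < P"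
  shows "((\<lambda>P. P powr (- n / 2) * J0 (1 / (2 * P))) has_real_derivative
           P powr (- n / 2) * (- n / (2 * P) * J0 (1 / (2 * P)) - J1 (1 / (2 * P)) / (2 * P\<^sup>2))) (at P)"
    and "((\<lambda>P. P powr (- n / 2) * (- n / (2 * P) * J0 (1 / (2 * P)) - J1 (1 / (2 * P)) / (2 * P\<^sup>2)))
           has_real_derivative
           P powr (- n / 2) * (n * (n + 2) * P\<^sup>2 * J0 (1 / (2 * P)) + 2 * (n + 2) * P * J1 (1 / (2 * P))
             + J2 (1 / (2 * P))) / (4 * P ^ 4)) (at P)"
proof -
  have t: "0 < 1 / (2 * P)" using P by simp
  have inner: "((\<lambda>P. 1 / (2 * P)) has_real_derivative - 1 / (2 * P\<^sup>2)) (at P)"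
    using P by (auto intro!: derivative_eq_intros simp: power2_eq_square field_simps)
  note D0 = DERIV_chain2[OF J0[OF t] inner] and D1 = DERIV_chain2[OF J1[OF t] inner]
  have pw: "((\<lambda>P. P powr (- n / 2)) has_real_derivative P powr (- n / 2) * (- n / (2 * P))) (at P)"
    using has_real_derivative_powr[OF P, of "- n / 2"] P by (simp add: powr_diff mult_ac)
  show "((\<lambda>P. P powr (- n / 2) * J0 (1 / (2 * P))) has_real_derivative
           P powr (- n / 2) * (- n / (2 * P) * J0 (1 / (2 * P)) - J1 (1 / (2 * P)) / (2 * P\<^sup>2))) (at P)"
    by (rule DERIV_cong[OF DERIV_mult[OF pw D0]]) (simp add: algebra_simps)
  have c1: "((\<lambda>P. - n / (2 * P)) has_real_derivative n / (2 * P\<^sup>2)) (at P)"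
    using P by (auto intro!: derivative_eq_intros simp: power2_eq_square field_simps)
  have c2: "((\<lambda>P. J1 (1 / (2 * P)) / (2 * P\<^sup>2)) has_real_derivative
      (J2 (1 / (2 * P)) * (- 1 / (2 * P\<^sup>2)) * (2 * P\<^sup>2) - J1 (1 / (2 * P)) * (4 * P)) / (2 * P\<^sup>2)\<^sup>2) (at P)"
    using P by (auto intro!: derivative_eq_intros D1 simp: power2_eq_square)
  show "((\<lambda>P. P powr (- n / 2) * (- n / (2 * P) * J0 (1 / (2 * P)) - J1 (1 / (2 * P)) / (2 * P\<^sup>2)))
           has_real_derivative
           P powr (- n / 2) * (n * (n + 2) * P\<^sup>2 * J0 (1 / (2 * P)) + 2 * (n + 2) * P * J1 (1 / (2 * P))
             + J2 (1 / (2 * P))) / (4 * P ^ 4)) (at P)"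
    apply (rule DERIV_cong[OF DERIV_mult[OF pw DERIV_diff[OF DERIV_mult[OF c1 D0] c2]]])
    using P by (simp add: divide_simps) algebra
qed

text \<open>For the cell of \<open>s j\<close> translated by \<open>- s i\<close> this is the
  pairwise error probability. The analysis in the noise power is carried out for general sets
  \<open>A\<close>.\<close>

definition noise_mass :: "(real ^ 'n) set \<Rightarrow> real \<Rightarrow> real" where
  "noise_mass A P = (LINT x : A | lborel. noise_density P x)"

text \<open>With r = |x|^2 and n the dimension, the second derivative of
  \<open>noise_density P x\<close> in \<open>P\<close> is this polynomial times
  \<open>noise_density P x / (4 * P ^ 4)\<close>.\<close>

definition curvature_poly :: "real \<Rightarrow> real \<Rightarrow> real \<Rightarrow> real" where
  "curvature_poly n P r = r\<^sup>2 - 2 * (n + 2) * P * r + n * (n + 2) * P\<^sup>2"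

text \<open>Completing the square in r leaves (n + 2)^2 - n (n + 2) = 2 (n + 2), which explains the
  square root in both mode conditions.\<close>

lemma curvature_poly_factor:
  assumes "0 \<le> n"
  shows "curvature_poly n P r =
    (r - (n + 2 + sqrt (2 * (n + 2))) * P) * (r - (n + 2 - sqrt (2 * (n + 2))) * P)"
proof -
  define w where "w = sqrt (2 * (n + 2))"
  have "w\<^sup>2 = 2 * (n + 2)" using assms by (simp add: w_def)
  then have "(r - (n + 2 + w) * P) * (r - (n + 2 - w) * P) = curvature_poly n P r"
    unfolding curvature_poly_def by algebra
  then show ?thesis by (simp add: w_def)
qed

lemma curvature_poly_nonneg:
  assumes "0 \<le> n" "0 < P"
    and "(n + 2 + sqrt (2 * (n + 2))) * P \<le> r \<or> r \<le> (n + 2 - sqrt (2 * (n + 2))) * P"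
  shows "0 \<le> curvature_poly n P r"
proof -
  have "(n + 2 - sqrt (2 * (n + 2))) * P \<le> (n + 2 + sqrt (2 * (n + 2))) * P"
    using assms(1,2) by (intro mult_right_mono) auto
  then show ?thesis
    using assms(3) by (auto simp: curvature_poly_factor[OF assms(1)] zero_le_mult_iff)
qed

lemma noise_density_eq:
  fixes x :: "real ^ 'n"
  shows "noise_density P x = (2 * pi) powr (- real CARD('n) / 2) *
    (P powr (- real CARD('n) / 2) * exp (1 / (2 * P) * - (norm x)\<^sup>2))"
  by (simp add: noise_density_def powr_mult)

lemma convex_on_noise_density:
  fixes x :: "real ^ 'n"
  assumes "convex I" "I \<subseteq> {0<..}"
    and "\<And>P. P \<in> I \<Longrightarrow> 0 \<le> curvature_poly (real CARD('n)) P ((norm x)\<^sup>2)"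
  shows "convex_on I (\<lambda>P. noise_density P x)"
proof -
  define n r where "n = real CARD('n)" and "r = - (norm x)\<^sup>2"
  \<comment> \<open>\<open>J k\<close> is the \<open>k\<close>-th derivative in t of exp (t r).
    Since r is minus the squared norm, the term with \<open>J (Suc 0)\<close> enters with a plus
    sign but yields the negative linear term of \<open>curvature_poly\<close>.\<close>
  define J where "J = (\<lambda>k t. r ^ k * exp (t * r))"
  have J: "(J k has_real_derivative J (Suc k) t) (at t)" for k t
    unfolding J_def by (auto intro!: derivative_eq_intros)
  note D = powr_mult_has_second_derivative[OF J J, of _ n]
  have "convex_on I (\<lambda>P. P powr (- n / 2) * J 0 (1 / (2 * P)))"
  proof (rule f''_ge0_imp_convex[OF assms(1) D(1) D(2)])
    fix P assume P: "P \<in> I"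
    have "(norm x)\<^sup>2 = - r" by (simp add: r_def)
    then have "n * (n + 2) * P\<^sup>2 * J 0 (1 / (2 * P)) + 2 * (n + 2) * P * J (Suc 0) (1 / (2 * P))
        + J (Suc (Suc 0)) (1 / (2 * P)) = curvature_poly n P ((norm x)\<^sup>2) * exp (1 / (2 * P) * r)"
      unfolding J_def curvature_poly_def by (simp add: algebra_simps power2_eq_square)
    then show "0 \<le> P powr (- n / 2) * (n * (n + 2) * P\<^sup>2 * J 0 (1 / (2 * P))
        + 2 * (n + 2) * P * J (Suc 0) (1 / (2 * P)) + J (Suc (Suc 0)) (1 / (2 * P))) / (4 * P ^ 4)"
      using assms(3)[OF P] by (simp add: n_def)
  qed (use assms(2) in auto)
  then have "convex_on I (\<lambda>P. (2 * pi) powr (- n / 2) * (P powr (- n / 2) * J 0 (1 / (2 * P))))"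
    by (rule convex_on_cmul[rotated]) simp
  then show ?thesis by (simp add: noise_density_eq[abs_def] J_def n_def r_def)
qed

lemma set_integrable_noise_density:
  fixes A :: "(real ^ 'n) set"
  assumes "A \<in> sets borel" "0 < P"
  shows "set_integrable lborel A (noise_density P)"
proof (rule set_integrable_subset)
  show "set_integrable lborel UNIV (noise_density P :: real ^ 'n \<Rightarrow> real)"
    using integrable_gaussian[OF assms(2), where 'a="real ^ 'n"]
    by (simp add: set_integrable_def noise_density_def)
qed (use assms in auto)

text \<open>The convexity inequality itself is integrated, instead of a second derivative. Hence
  \<open>A\<close> may be unbounded, as cells of a finite constellation can be.\<close>

lemma convex_on_noise_mass:
  fixes A :: "(real ^ 'n) set"
  assumes A: "A \<in> sets borel" and I: "convex I" "I \<subseteq> {0<..}"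
    and nn: "\<And>P x. P \<in> I \<Longrightarrow> x \<in> A \<Longrightarrow> 0 \<le> curvature_poly (real CARD('n)) P ((norm x)\<^sup>2)"
  shows "convex_on I (noise_mass A)"
proof (rule convex_onI)
  fix t P Q :: real assume t: "0 < t" "t < 1" and PQ: "P \<in> I" "Q \<in> I"
  let ?S = "(1 - t) *\<^sub>R P + t *\<^sub>R Q"
  have S: "?S \<in> I" using I(1) PQ t by (simp add: convex_alt)
  have int: "set_integrable lborel A (noise_density R)" if "R \<in> I" for R
    using that I(2) by (intro set_integrable_noise_density A) auto
  have "noise_mass A ?S \<le>
      (LINT x : A | lborel. (1 - t) * noise_density P x + t * noise_density Q x)"
    unfolding noise_mass_def
  proof (rule set_integral_mono)
    fix x assume "x \<in> A"
    then have "convex_on I (\<lambda>P. noise_density P x)"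
      by (intro convex_on_noise_density I nn)
    from convex_onD[OF this] show "noise_density ?S x \<le> (1 - t) * noise_density P x + t * noise_density Q x"
      using t PQ by simp
  qed (use int[OF S] int[OF PQ(1)] int[OF PQ(2)] in \<open>auto intro!: set_integral_add(1)\<close>)
  also have "\<dots> = (1 - t) * noise_mass A P + t * noise_mass A Q"
    using int[OF PQ(1)] int[OF PQ(2)] by (simp add: noise_mass_def set_integral_add(2))
  finally show "noise_mass A ?S \<le> (1 - t) * noise_mass A P + t * noise_mass A Q" .
qed (rule I(1))

text \<open>The \<open>k\<close>-th derivative in \<open>t\<close> of the integral of \<open>exp (- t |x|\<^sup>2)\<close> over \<open>A\<close>; the noise
  power enters as \<open>t = 1 / (2 P)\<close>.\<close>

definition radial_laplace :: "nat \<Rightarrow> ('a::euclidean_space) set \<Rightarrow> real \<Rightarrow> real" where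
  "radial_laplace k A t =
     (\<integral>x. indicator A x * (- (norm x)\<^sup>2) ^ k * exp (t * - (norm x)\<^sup>2) \<partial>lborel)"

lemma integrable_indicator_norm_power:
  fixes A :: "'a::euclidean_space set"
  assumes "A \<in> sets borel" "bounded A"
  shows "integrable lborel (\<lambda>x. indicator A x * (- (norm x)\<^sup>2) ^ k)"
proof -
  obtain B where B: "\<And>x. x \<in> A \<Longrightarrow> norm x \<le> B" using assms(2) by (auto simp: bounded_iff)
  have "emeasure lborel A < \<infinity>" using emeasure_bounded_finite[OF assms(2)] .
  then have "integrable lborel (\<lambda>x. (B\<^sup>2) ^ k * indicator A x :: real)"
    using assms(1) by simp
  then show ?thesis
  proof (rule Bochner_Integration.integrable_bound)
    show "AE x in lborel. norm (indicator A x * (- (norm x)\<^sup>2) ^ k) \<le> norm ((B\<^sup>2) ^ k * indicator A x :: real)"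
      using B by (intro AE_I2)
        (auto simp: indicator_def power_abs simp flip: power_mult intro!: power_mono)
    show "(\<lambda>x. indicator A x * (- (norm x)\<^sup>2) ^ k) \<in> borel_measurable lborel"
      using assms(1) by measurable
  qed
qed

lemma norm_sq_bound_on_bounded:
  fixes A :: "'a::real_normed_vector set"
  assumes "bounded A"
  shows "\<exists>R. \<forall>x. indicator A x * (- (norm x)\<^sup>2) ^ k \<noteq> (0::real) \<longrightarrow> \<bar>- (norm x)\<^sup>2\<bar> \<le> R"
proof -
  obtain B where "\<And>x. x \<in> A \<Longrightarrow> norm x \<le> B" using assms by (auto simp: bounded_iff)
  then show ?thesis by (intro exI[of _ "B\<^sup>2"]) (auto simp: indicator_def intro: power_mono split: if_splits)
qed

lemma integrable_radial_laplace:
  fixes A :: "'a::euclidean_space set"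
  assumes "A \<in> sets borel" "bounded A"
  shows "integrable lborel (\<lambda>x. indicator A x * (- (norm x)\<^sup>2) ^ k * exp (t * - (norm x)\<^sup>2))"
proof -
  obtain R where R: "\<And>x. indicator A x * (- (norm x)\<^sup>2) ^ k \<noteq> (0::real) \<Longrightarrow> \<bar>- (norm x)\<^sup>2\<bar> \<le> R"
    using norm_sq_bound_on_bounded[OF assms(2), of k] by blast
  from integrable_mult_exp[where y = t and \<phi> = "\<lambda>x. - (norm x)\<^sup>2",
      OF integrable_indicator_norm_power[OF assms, of k] _ R]
  show ?thesis by simp
qed

lemma has_real_derivative_radial_laplace:
  fixes A :: "'a::euclidean_space set"
  assumes "A \<in> sets borel" "bounded A"
  shows "(radial_laplace k A has_real_derivative radial_laplace (Suc k) A t) (at t)"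
proof -
  obtain R where R: "\<And>x. indicator A x * (- (norm x)\<^sup>2) ^ k \<noteq> (0::real) \<Longrightarrow> \<bar>- (norm x)\<^sup>2\<bar> \<le> R"
    using norm_sq_bound_on_bounded[OF assms(2), of k] by blast
  from has_field_derivative_integral_exp[where z = t and \<phi> = "\<lambda>x. - (norm x)\<^sup>2",
      OF integrable_indicator_norm_power[OF assms, of k] _ R]
  show ?thesis by (simp add: radial_laplace_def[abs_def] mult_ac)
qed

text \<open>On a bounded set the exponent is bounded, so the same integral with a complex parameter
  is differentiable everywhere.\<close>

lemma radial_laplace_holomorphic_extension:
  fixes A :: "'a::euclidean_space set"
  assumes "A \<in> sets borel" "bounded A"
  obtains G where "G holomorphic_on UNIV" "\<And>t. G (of_real t) = of_real (radial_laplace 0 A t)"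
proof -
  obtain R where R: "\<And>x. indicator A x * (- (norm x)\<^sup>2) ^ 0 \<noteq> (0::real) \<Longrightarrow> \<bar>- (norm x)\<^sup>2\<bar> \<le> R"
    using norm_sq_bound_on_bounded[OF assms(2), of 0] by blast
  note D = has_field_derivative_integral_exp[where 'b = complex and \<phi> = "\<lambda>x. - (norm x)\<^sup>2",
      OF integrable_indicator_norm_power[OF assms, of 0] _ R]
  show ?thesis
  proof (rule that)
    show "(\<lambda>z. \<integral>x. of_real (indicator A x * (- (norm x)\<^sup>2) ^ 0) * exp (z * of_real (- (norm x)\<^sup>2)) \<partial>lborel)
        holomorphic_on UNIV"
      using D by (subst holomorphic_on_open) (auto simp del: power_0 of_real_minus)
    show "(\<integral>x. of_real (indicator A x * (- (norm x)\<^sup>2) ^ 0) * exp (of_real t * of_real (- (norm x)\<^sup>2)) \<partial>lborel)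
        = complex_of_real (radial_laplace 0 A t)" for t
      unfolding radial_laplace_def integral_complex_of_real[symmetric]
      by (simp only: of_real_mult flip: exp_of_real)
  qed
qed

lemma noise_mass_eq:
  fixes A :: "(real ^ 'n) set"
  shows "noise_mass A P = (2 * pi) powr (- real CARD('n) / 2) *
    (P powr (- real CARD('n) / 2) * radial_laplace 0 A (1 / (2 * P)))"
proof -
  have "noise_mass A P = (\<integral>x. ((2 * pi) powr (- real CARD('n) / 2) * P powr (- real CARD('n) / 2)) *
      (indicator A x * (- (norm x)\<^sup>2) ^ 0 * exp (1 / (2 * P) * - (norm x)\<^sup>2)) \<partial>lborel)"
    unfolding noise_mass_def set_lebesgue_integral_def noise_density_eq
    by (intro Bochner_Integration.integral_cong) auto
  also have "\<dots> = ((2 * pi) powr (- real CARD('n) / 2) * P powr (- real CARD('n) / 2)) *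
      radial_laplace 0 A (1 / (2 * P))"
    unfolding radial_laplace_def by (rule integral_mult_right_zero)
  finally show ?thesis by simp
qed

text \<open>Joins the three integrals that occur in the second derivative into one, whose integrand
  has on \<open>A\<close> the sign of \<open>curvature_poly\<close>.\<close>

lemma curvature_integral:
  fixes A :: "'a::euclidean_space set" and n P :: real
  assumes "A \<in> sets borel" "bounded A"
  defines "f \<equiv> \<lambda>x. indicator A x * curvature_poly n P ((norm x)\<^sup>2) * exp (1 / (2 * P) * - (norm x)\<^sup>2)"
  shows "integrable lborel f"
    and "integral\<^sup>L lborel f = n * (n + 2) * P\<^sup>2 * radial_laplace 0 A (1 / (2 * P))
      + 2 * (n + 2) * P * radial_laplace (Suc 0) A (1 / (2 * P))
      + radial_laplace (Suc (Suc 0)) A (1 / (2 * P))"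
proof -
  define g where "g = (\<lambda>k x. indicator A x * (- (norm x)\<^sup>2) ^ k * exp (1 / (2 * P) * - (norm x)\<^sup>2))"
  have g: "integrable lborel (g k)" "radial_laplace k A (1 / (2 * P)) = integral\<^sup>L lborel (g k)" for k
    unfolding g_def radial_laplace_def by (rule integrable_radial_laplace[OF assms(1,2)] refl)+
  have f: "f = (\<lambda>x. n * (n + 2) * P\<^sup>2 * g 0 x + 2 * (n + 2) * P * g (Suc 0) x + g (Suc (Suc 0)) x)"
  proof
    fix x
    define i e r where "i = (indicator A x :: real)" and "e = exp (1 / (2 * P) * - (norm x)\<^sup>2)"
      and "r = (norm x)\<^sup>2"
    show "f x = n * (n + 2) * P\<^sup>2 * g 0 x + 2 * (n + 2) * P * g (Suc 0) x + g (Suc (Suc 0)) x"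
      unfolding f_def g_def e_def[symmetric] i_def[symmetric] unfolding r_def[symmetric] curvature_poly_def
      by (simp add: algebra_simps power2_eq_square)
  qed
  show "integrable lborel f" unfolding f
    by (intro Bochner_Integration.integrable_add integrable_mult_right g(1))
  show "integral\<^sup>L lborel f = n * (n + 2) * P\<^sup>2 * radial_laplace 0 A (1 / (2 * P))
      + 2 * (n + 2) * P * radial_laplace (Suc 0) A (1 / (2 * P))
      + radial_laplace (Suc (Suc 0)) A (1 / (2 * P))"
    unfolding f g(2) using g(1) by simp
qed

lemma deriv2_noise_mass:
  fixes A :: "(real ^ 'n) set"
  assumes A: "A \<in> sets borel" "bounded A" and P: "0 < P"
  shows "(deriv ^^ 2) (noise_mass A) P =
    (2 * pi) powr (- real CARD('n) / 2) * (P powr (- real CARD('n) / 2) / (4 * P ^ 4)) *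
    (\<integral>x. indicator A x * curvature_poly (real CARD('n)) P ((norm x)\<^sup>2) * exp (1 / (2 * P) * - (norm x)\<^sup>2) \<partial>lborel)"
proof -
  define n c where "n = real CARD('n)" and "c = (2 * pi) powr (- n / 2)"
  let ?J = "\<lambda>k. radial_laplace k A"
  define F1 where "F1 = (\<lambda>P. P powr (- n / 2) * (- n / (2 * P) * ?J 0 (1 / (2 * P))
    - ?J (Suc 0) (1 / (2 * P)) / (2 * P\<^sup>2)))"
  note D = powr_mult_has_second_derivative[OF
      has_real_derivative_radial_laplace[OF A] has_real_derivative_radial_laplace[OF A], of _ n]
  have 1: "deriv (noise_mass A) Q = c * F1 Q" if "0 < Q" for Q
  proof -
    have "(noise_mass A has_real_derivative c * F1 Q) (at Q)"
      unfolding noise_mass_eq[abs_def] F1_def c_def n_def[symmetric]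
      by (intro DERIV_cmult D(1) that)
    then show ?thesis by (rule DERIV_imp_deriv)
  qed
  have "\<forall>\<^sub>F Q in nhds P. Q \<in> {0<..}" using P by (intro eventually_nhds_in_open) auto
  then have "\<forall>\<^sub>F Q in nhds P. deriv (noise_mass A) Q = c * F1 Q"
    by eventually_elim (simp add: 1)
  \<comment> \<open>The formula for the first derivative is available only at positive points, which
    suffices because \<open>deriv\<close> at \<open>P\<close> depends only on the values near
    \<open>P\<close>.\<close>
  then have "(deriv ^^ 2) (noise_mass A) P = deriv (\<lambda>Q. c * F1 Q) P"
    by (simp add: numeral_2_eq_2 deriv_cong_ev)
  also have "\<dots> = c * (P powr (- n / 2) * (n * (n + 2) * P\<^sup>2 * ?J 0 (1 / (2 * P))
      + 2 * (n + 2) * P * ?J (Suc 0) (1 / (2 * P)) + ?J (Suc (Suc 0)) (1 / (2 * P))) / (4 * P ^ 4))"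
    unfolding F1_def by (intro DERIV_imp_deriv DERIV_cmult D(2) P)
  finally show ?thesis unfolding c_def n_def curvature_integral(2)[OF A] by simp
qed

text \<open>If the integral of the nonnegative integrand were zero, the open set \<open>U\<close>
  would be covered by a null set and the two spheres on which \<open>curvature_poly\<close>
  vanishes, and would be negligible.\<close>

lemma deriv2_noise_mass_pos:
  fixes A :: "(real ^ 'n) set"
  assumes A: "A \<in> sets borel" "bounded A" and U: "open U" "U \<noteq> {}" "U \<subseteq> A" and P: "0 < P"
    and nn: "\<And>x. x \<in> A \<Longrightarrow> 0 \<le> curvature_poly (real CARD('n)) P ((norm x)\<^sup>2)"
  shows "0 < (deriv ^^ 2) (noise_mass A) P"
proof -
  define n where "n = real CARD('n)"
  define f where "f = (\<lambda>x :: real ^ 'n. indicator A x * curvature_poly n P ((norm x)\<^sup>2) *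
    exp (1 / (2 * P) * - (norm x)\<^sup>2))"
  have int: "integrable lborel f" unfolding f_def by (rule curvature_integral(1)[OF A])
  have f_nn: "0 \<le> f x" for x using nn by (auto simp: f_def n_def indicator_def)
  have "integral\<^sup>L lborel f \<noteq> 0"
  proof
    assume "integral\<^sup>L lborel f = 0"
    then have "AE x in lborel. f x = 0"
      using integral_nonneg_eq_0_iff_AE[OF int] f_nn by simp
    then have "{x. f x \<noteq> 0} \<in> null_sets lborel"
      using int by (subst (asm) AE_iff_null) auto
    then have N: "negligible {x. f x \<noteq> 0}"
      by (simp add: negligible_iff_null_sets null_sets_completionI)
    let ?r = "\<lambda>e. sqrt ((n + 2 + e * sqrt (2 * (n + 2))) * P)"
    have "U \<subseteq> {x. f x \<noteq> 0} \<union> (sphere 0 (?r 1) \<union> sphere 0 (?r (-1)))"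
    proof
      fix x assume "x \<in> U"
      then have "x \<in> A" using U(3) by auto
      have "norm x = ?r 1 \<or> norm x = ?r (-1)" if "f x = 0"
      proof -
        have "(norm x)\<^sup>2 = (n + 2 + 1 * sqrt (2 * (n + 2))) * P
            \<or> (norm x)\<^sup>2 = (n + 2 + (-1) * sqrt (2 * (n + 2))) * P"
          using that \<open>x \<in> A\<close> by (auto simp: f_def curvature_poly_factor n_def)
        then show ?thesis by (metis abs_norm_cancel real_sqrt_abs)
      qed
      then show "x \<in> {x. f x \<noteq> 0} \<union> (sphere 0 (?r 1) \<union> sphere 0 (?r (-1)))" by auto
    qed
    moreover have "negligible ({x. f x \<noteq> 0} \<union> (sphere 0 (?r 1) \<union> sphere 0 (?r (-1))))"
      using N by (intro negligible_Un negligible_sphere)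
    ultimately have "negligible U" by (rule negligible_subset[rotated])
    with U open_not_negligible show False by blast
  qed
  then have "0 < integral\<^sup>L lborel f"
    using Bochner_Integration.integral_nonneg[of lborel f] f_nn by (simp add: less_le)
  then show ?thesis
    unfolding deriv2_noise_mass[OF A P] using P by (simp add: f_def n_def)
qed

text \<open>The right half plane avoids the branch cut of \<open>Ln\<close>, needed to extend the
  power of \<open>P\<close>, and the pole of 1 / (2 z).\<close>

lemma noise_mass_holomorphic_extension:
  fixes A :: "(real ^ 'n) set"
  assumes "A \<in> sets borel" "bounded A"
  obtains H where "H holomorphic_on {z. 0 < Re z}"
    "\<And>P. 0 < P \<Longrightarrow> H (of_real P) = of_real (noise_mass A P)"
proof -
  obtain G where G: "G holomorphic_on UNIV" "\<And>t. G (of_real t) = of_real (radial_laplace 0 A t)"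
    using radial_laplace_holomorphic_extension[OF assms] by blast
  define n where "n = real CARD('n)"
  let ?H = "\<lambda>z. of_real ((2 * pi) powr (- n / 2)) * (exp (of_real (- n / 2) * Ln z) * G (1 / (2 * z)))"
  show ?thesis
  proof (rule that)
    have "(\<lambda>z. 1 / (2 * z)) holomorphic_on {z. 0 < Re z}"
      by (intro holomorphic_intros) auto
    from holomorphic_on_compose_gen[OF this G(1)]
    have "(\<lambda>z. G (1 / (2 * z))) holomorphic_on {z. 0 < Re z}" by (simp add: o_def)
    moreover have "(\<lambda>z. exp (of_real (- n / 2) * Ln z)) holomorphic_on {z. 0 < Re z}"
      by (intro holomorphic_intros) (auto simp: complex_nonpos_Reals_iff)
    ultimately show "?H holomorphic_on {z. 0 < Re z}"
      by (intro holomorphic_on_mult holomorphic_on_const)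
    fix P :: real assume P: "0 < P"
    have "exp (of_real (- n / 2) * Ln (of_real P)) = (of_real (P powr (- n / 2)) :: complex)"
      using P by (simp add: Ln_of_real powr_def flip: exp_of_real)
    moreover have "G (1 / (2 * of_real P)) = of_real (radial_laplace 0 A (1 / (2 * P)))"
      using G(2)[of "1 / (2 * P)"] by simp
    ultimately show "?H (of_real P) = of_real (noise_mass A P)"
      by (simp add: noise_mass_eq n_def)
  qed
qed

section \<open>Voronoi cells and noise modes\<close>

lemma closed_voronoi: "closed (voronoi s k)"
  unfolding voronoi_def by (intro closed_Collect_all closed_Collect_le continuous_intros)

text \<open>Strict inequalities against the finitely many other points define an open set, which
  contains \<open>s k\<close> because the points are distinct.\<close>

lemma open_subset_voronoi:
  fixes s :: "'m::finite \<Rightarrow> real ^ 'n"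
  assumes "inj s"
  obtains U where "open U" "s k \<in> U" "U \<subseteq> voronoi s k"
proof
  let ?U = "\<Inter>l\<in>- {k}. {r. norm (r - s k) < norm (r - s l)}"
  show "open ?U" by (intro open_INT ballI open_Collect_less continuous_intros) simp
  show "s k \<in> ?U" using assms by (auto simp: inj_eq)
  show "?U \<subseteq> voronoi s k"
  proof
    fix r assume r: "r \<in> ?U"
    have "norm (r - s k) \<le> norm (r - s l)" for l
      using r by (cases "l = k") (auto intro: less_imp_le)
    then show "r \<in> voronoi s k" by (simp add: voronoi_def)
  qed
qed

text \<open>The difference |r - s i|^2 - |r - s j|^2 is affine in r and strictly increasing in the
  direction \<open>s j - s i\<close>. It is nonnegative at \<open>r\<close>, so a small step makes
  it positive, which is impossible inside the cell of \<open>s i\<close>.\<close>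

lemma voronoi_not_interior:
  assumes "r \<in> voronoi s j" "s i \<noteq> s j"
  shows "r \<notin> interior (voronoi s i)"
proof
  assume "r \<in> interior (voronoi s i)"
  then obtain e where e: "0 < e" "ball r e \<subseteq> voronoi s i" by (auto simp: mem_interior)
  define d where "d = s j - s i"
  have d: "0 < norm d" using assms(2) by (simp add: d_def)
  \<comment> \<open>The step \<open>t *\<^sub>R d\<close> has length \<open>e / 2\<close>, so it
    stays in the ball.\<close>
  define t where "t = e / (2 * norm d)"
  have t: "0 < t" using e d by (simp add: t_def)
  have "r + t *\<^sub>R d \<in> ball r e" using e d by (simp add: dist_norm t_def)
  with e have "norm (r + t *\<^sub>R d - s i) \<le> norm (r + t *\<^sub>R d - s j)" by (auto simp: voronoi_def)
  then have "(norm ((r - s i) + t *\<^sub>R d))\<^sup>2 \<le> (norm ((r - s j) + t *\<^sub>R d))\<^sup>2"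
    by (intro power_mono) (simp_all add: algebra_simps)
  moreover have "(norm (r - s j))\<^sup>2 \<le> (norm (r - s i))\<^sup>2"
    using assms(1) by (intro power_mono) (auto simp: voronoi_def)
  ultimately have "t * ((r - s i) \<bullet> d) \<le> t * ((r - s j) \<bullet> d)"
    by (simp add: power2_norm_eq_inner inner_simps inner_commute algebra_simps)
  then have "(r - s i) \<bullet> d \<le> (r - s j) \<bullet> d" using t by simp
  then have "d \<bullet> d \<le> 0" by (simp add: d_def inner_simps inner_commute)
  with d show False by (simp flip: power2_norm_eq_inner)
qed

text \<open>The segment from \<open>s i\<close> to \<open>r\<close> starts in the interior of the
  cell of \<open>s i\<close> and ends outside that interior, so it meets the boundary no farther
  from \<open>s i\<close> than \<open>r\<close>. The interior is used because \<open>r\<close> may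
  lie on the common boundary of both cells.\<close>

lemma d_min_le:
  fixes s :: "'m::finite \<Rightarrow> real ^ 'n"
  assumes "inj s" "i \<noteq> j" "r \<in> voronoi s j"
  shows "d_min s i \<le> norm (r - s i)"
proof -
  obtain U where "open U" "s i \<in> U" "U \<subseteq> voronoi s i" using open_subset_voronoi[OF assms(1)] .
  then have "s i \<in> interior (voronoi s i)" by (meson interior_maximal subsetD)
  moreover have "r \<notin> interior (voronoi s i)"
    using assms by (intro voronoi_not_interior) (auto simp: inj_eq)
  ultimately have "closed_segment (s i) r \<inter> frontier (interior (voronoi s i)) \<noteq> {}"
    by (intro connected_Int_frontier) (auto intro: connected_segment)
  then obtain z where z: "z \<in> closed_segment (s i) r" "z \<in> frontier (voronoi s i)"
    using frontier_interior_subset by blast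
  have "d_min s i \<le> dist (s i) z" unfolding d_min_def using z(2) by (rule infdist_le)
  also have "\<dots> \<le> norm (r - s i)"
    using segment_bound(1)[OF z(1)] by (simp add: dist_norm norm_minus_commute)
  finally show ?thesis .
qed

text \<open>The ray from \<open>a\<close> through \<open>r\<close>, continued beyond
  \<open>r\<close>, leaves the bounded set and crosses its frontier on the way.\<close>

lemma frontier_farther:
  fixes S :: "'a::euclidean_space set"
  assumes "bounded S" "r \<in> S"
  obtains z where "z \<in> frontier S" "dist a r \<le> dist a z"
proof (cases "r = a")
  case True
  have "frontier S \<noteq> {}" using assms by (intro frontier_not_empty) (auto simp: not_bounded_UNIV)
  then show ?thesis using that True by auto
next
  case False
  define d where "d = r - a"
  have d: "0 < norm d" using False by (simp add: d_def)
  obtain B where B: "\<And>x. x \<in> S \<Longrightarrow> dist a x \<le> B"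
    using assms(1) bounded_any_center[of S a] by auto
  \<comment> \<open>Going \<open>\<bar>B\<bar>\<close> beyond \<open>r\<close> reaches distance
    \<open>norm d + \<bar>B\<bar>\<close>, which exceeds the bound \<open>B\<close> on
    \<open>S\<close>.\<close>
  define y where "y = r + (\<bar>B\<bar> / norm d) *\<^sub>R d"
  have on_ray: "dist a (r + u *\<^sub>R d) = norm d + u * norm d" if "0 \<le> u" for u
  proof -
    have "a - (r + u *\<^sub>R d) = - ((1 + u) *\<^sub>R d)" by (simp add: d_def algebra_simps)
    then have "dist a (r + u *\<^sub>R d) = \<bar>1 + u\<bar> * norm d"
      by (simp only: dist_norm norm_minus_cancel norm_scaleR)
    then show ?thesis using that by (simp add: algebra_simps)
  qed
  have "dist a y = norm d + \<bar>B\<bar>" unfolding y_def using on_ray[of "\<bar>B\<bar> / norm d"] d by simp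
  then have "B < dist a y" using d by linarith
  then have "y \<notin> S" using B by force
  then have "closed_segment r y \<inter> frontier S \<noteq> {}"
    using assms(2) by (intro connected_Int_frontier) (auto intro: connected_segment)
  then obtain z where z: "z \<in> closed_segment r y" "z \<in> frontier S" by blast
  from z(1) obtain u where u: "0 \<le> u" "u \<le> 1" "z = (1 - u) *\<^sub>R r + u *\<^sub>R y"
    by (auto simp: closed_segment_def)
  have "z = r + (u * (\<bar>B\<bar> / norm d)) *\<^sub>R d" by (simp add: u y_def algebra_simps)
  then have "dist a z = norm d + u * (\<bar>B\<bar> / norm d) * norm d" using on_ray u by simp
  moreover have "dist a r = norm d" by (simp add: d_def dist_norm norm_minus_commute)
  ultimately have "dist a r \<le> dist a z" using u by simp
  with that z show ?thesis by blast
qed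

text \<open>Although \<open>d_max\<close> looks only at the boundary, it bounds the whole cell: each
  point of a bounded cell is dominated by a boundary point, and for an unbounded cell the value is
  infinite.\<close>

lemma norm_le_d_max:
  assumes "r \<in> voronoi s j"
  shows "ereal (norm (r - s j)) \<le> d_max s j"
proof (cases "bounded (voronoi s j)")
  case True
  obtain z where "z \<in> frontier (voronoi s j)" "dist (s j) r \<le> dist (s j) z"
    using frontier_farther[OF True assms] .
  then show ?thesis
    using True by (auto simp: d_max_def dist_norm norm_minus_commute intro!: SUP_upper2)
qed (simp add: d_max_def)

text \<open>A single element of the large noise mode forces \<open>d_max\<close> to be finite. The
  cell is then bounded, and the condition in extended reals becomes a real one.\<close>

lemma large_noise_modeD:
  fixes s :: "'m \<Rightarrow> real ^ 'n"
  assumes "P \<in> large_noise_mode s i j"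
  obtains m where "d_max s j = ereal m" "bounded (voronoi s j)"
    "large_noise_mode s i j = {P. 0 < P \<and> (norm (s i - s j) + m)\<^sup>2 \<le>
      (real CARD('n) + 2 - sqrt (2 * (real CARD('n) + 2))) * P}"
proof -
  have fin: "(ereal (norm (s i - s j)) + d_max s j)\<^sup>2 < \<infinity>"
    using assms by (auto simp: large_noise_mode_def intro: le_less_trans)
  have "s j \<in> voronoi s j" by (simp add: voronoi_def)
  from norm_le_d_max[OF this] have nn: "0 \<le> d_max s j" by (simp add: zero_ereal_def)
  with fin obtain m where m: "d_max s j = ereal m" by (cases "d_max s j") auto
  show ?thesis
  proof (rule that[OF m])
    show "bounded (voronoi s j)" using m by (auto simp: d_max_def split: if_splits)
  qed (simp add: large_noise_mode_def m)
qed

section \<open>Sign of the curvature on the translated cell\<close>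

abbreviation error_region :: "('m \<Rightarrow> real ^ 'n) \<Rightarrow> 'm \<Rightarrow> 'm \<Rightarrow> (real ^ 'n) set" where
  "error_region s i j \<equiv> (\<lambda>r. r - s i) ` voronoi s j"

text \<open>The translated cell stays outside the open ball of radius \<open>d_min s i\<close> about
  the origin, so every squared norm is at least the larger root.\<close>

lemma curvature_nonneg_small_noise:
  fixes s :: "'m::finite \<Rightarrow> real ^ 'n"
  assumes "inj s" "i \<noteq> j" "P \<in> small_noise_mode s i" "x \<in> error_region s i j"
  shows "0 \<le> curvature_poly (real CARD('n)) P ((norm x)\<^sup>2)"
proof (rule curvature_poly_nonneg)
  have "d_min s i \<le> norm x" using assms by (auto intro: d_min_le)
  moreover have "0 \<le> d_min s i" by (simp add: d_min_def infdist_nonneg)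
  ultimately have "(d_min s i)\<^sup>2 \<le> (norm x)\<^sup>2" by (rule power_mono)
  then show "(real CARD('n) + 2 + sqrt (2 * (real CARD('n) + 2))) * P \<le> (norm x)\<^sup>2
      \<or> (norm x)\<^sup>2 \<le> (real CARD('n) + 2 - sqrt (2 * (real CARD('n) + 2))) * P"
    using assms(3) by (auto simp: small_noise_mode_def)
qed (use assms(3) in \<open>auto simp: small_noise_mode_def\<close>)

text \<open>By the triangle inequality through \<open>s j\<close>, the translated cell lies in the
  ball of radius \<open>norm (s i - s j) + m\<close>, so every squared norm is at most the smaller
  root.\<close>

lemma curvature_nonneg_large_noise:
  fixes s :: "'m \<Rightarrow> real ^ 'n"
  assumes P: "P \<in> large_noise_mode s i j" and x: "x \<in> error_region s i j"
  shows "0 \<le> curvature_poly (real CARD('n)) P ((norm x)\<^sup>2)"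
proof (rule curvature_poly_nonneg)
  from P obtain m where m: "d_max s j = ereal m"
    "large_noise_mode s i j = {P. 0 < P \<and> (norm (s i - s j) + m)\<^sup>2 \<le>
      (real CARD('n) + 2 - sqrt (2 * (real CARD('n) + 2))) * P}"
    by (rule large_noise_modeD)
  from x obtain r where r: "x = r - s i" "r \<in> voronoi s j" by auto
  have "norm x \<le> norm (s i - s j) + norm (r - s j)"
    unfolding r using norm_triangle_ineq[of "r - s j" "s j - s i"] by (simp add: norm_minus_commute)
  also have "\<dots> \<le> norm (s i - s j) + m" using norm_le_d_max[OF r(2)] m by simp
  finally have "(norm x)\<^sup>2 \<le> (norm (s i - s j) + m)\<^sup>2" by (intro power_mono) auto
  then show "(real CARD('n) + 2 + sqrt (2 * (real CARD('n) + 2))) * P \<le> (norm x)\<^sup>2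
      \<or> (norm x)\<^sup>2 \<le> (real CARD('n) + 2 - sqrt (2 * (real CARD('n) + 2))) * P"
    using P by (auto simp: m(2))
qed (use P in \<open>auto simp: large_noise_mode_def\<close>)

theorem theorem5:
  fixes s :: "'m::finite \<Rightarrow> real ^ 'n" and i j :: 'm
  assumes distinct_points: "inj s"
    and normalized: "(\<Sum>k\<in>UNIV. (norm (s k))\<^sup>2) / real CARD('m) = 1"
    and ij: "i \<noteq> j"
  shows "convex_on (small_noise_mode s i) (pairwise_error_prob s i j)
    \<and> convex_on (large_noise_mode s i j) (pairwise_error_prob s i j)
    \<and> finite (inflection_points (pairwise_error_prob s i j) (between_modes s i j))
    \<and> even (\<Sum>P \<in> inflection_points (pairwise_error_prob s i j) (between_modes s i j).
              inflection_multiplicity (pairwise_error_prob s i j) P)"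
proof -
  define n where "n = real CARD('n)"
  define \<alpha> \<beta> where "\<alpha> = n + 2 + sqrt (2 * (n + 2))" and "\<beta> = n + 2 - sqrt (2 * (n + 2))"
  have n: "0 < n" by (simp add: n_def)
  then have \<alpha>: "0 < \<alpha>" by (simp add: \<alpha>_def add_pos_nonneg)
  \<comment> \<open>After squaring this is 2 < n + 2. Positivity of \<beta> allows the large noise
    condition to be solved for the noise power.\<close>
  have "sqrt (2 * (n + 2)) < n + 2"
    using n by (intro real_less_lsqrt) (auto simp: power2_eq_square algebra_simps add_pos_pos)
  then have \<beta>: "0 < \<beta>" by (simp add: \<beta>_def)
  let ?A = "error_region s i j"
  define F where "F = noise_mass ?A"
  have F: "pairwise_error_prob s i j = F"
    by (simp add: fun_eq_iff pairwise_error_prob_def F_def noise_mass_def)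
  have "closed ?A" by (intro closed_translation_subtract closed_voronoi)
  then have A: "?A \<in> sets borel" by simp
  have small: "small_noise_mode s i = {0<..(d_min s i)\<^sup>2 / \<alpha>}"
    using \<alpha> by (auto simp: small_noise_mode_def \<alpha>_def n_def field_simps)
  have "convex_on (small_noise_mode s i) F"
    unfolding F_def
    by (rule convex_on_noise_mass[OF A _ _ curvature_nonneg_small_noise[OF distinct_points ij]])
      (auto simp: small)
  moreover have "convex (large_noise_mode s i j)"
  proof (cases "large_noise_mode s i j = {}")
    case False
    then obtain P where "P \<in> large_noise_mode s i j" by auto
    then obtain m where "large_noise_mode s i j = {P. 0 < P \<and> (norm (s i - s j) + m)\<^sup>2 \<le> \<beta> * P}"
      unfolding \<beta>_def n_def by (rule large_noise_modeD)
    also have "\<dots> = {0<..} \<inter> {(norm (s i - s j) + m)\<^sup>2 / \<beta>..}"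
      using \<beta> by (auto simp: field_simps)
    finally show ?thesis by (simp add: convex_Int)
  qed simp
  then have "convex_on (large_noise_mode s i j) F"
    unfolding F_def
    by (rule convex_on_noise_mass[OF A _ _ curvature_nonneg_large_noise])
      (auto simp: large_noise_mode_def)
  moreover have "finite (inflection_points F (between_modes s i j))
    \<and> even (\<Sum>P \<in> inflection_points F (between_modes s i j). inflection_multiplicity F P)"
  proof (cases "between_modes s i j = {}")
    case False
    then obtain P b where P: "0 < P" "P < b" "P \<notin> small_noise_mode s i" "P \<notin> large_noise_mode s i j"
      and small_ne: "small_noise_mode s i \<noteq> {}" and b: "b \<in> large_noise_mode s i j"
      by (auto simp: between_modes_def small)
    obtain m where bounded: "bounded (voronoi s j)"
      and large: "large_noise_mode s i j = {P. 0 < P \<and> (norm (s i - s j) + m)\<^sup>2 \<le> \<beta> * P}"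
      using b unfolding \<beta>_def n_def by (rule large_noise_modeD)
    \<comment> \<open>The thresholds at which the two mode conditions hold with equality. They
      belong to the modes themselves, so the values in between form the open interval from
      \<open>a\<close> to \<open>c\<close>.\<close>
    define a c where "a = (d_min s i)\<^sup>2 / \<alpha>" and "c = (norm (s i - s j) + m)\<^sup>2 / \<beta>"
    have large: "large_noise_mode s i j = {0<..} \<inter> {c..}"
      unfolding large c_def using \<beta> by (auto simp: field_simps)
    have a: "0 < a" using small_ne by (simp add: small a_def)
    have ac: "a < c" using P by (simp add: small large flip: a_def)
    have between: "between_modes s i j = {a<..<c}"
    proof (intro set_eqI iffI)
      fix Q assume Q: "Q \<in> {a<..<c}"
      have "a \<in> small_noise_mode s i" "c \<in> large_noise_mode s i j"
        using a ac by (auto simp: small large a_def)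
      moreover have "a < Q" "Q < c" "Q \<notin> small_noise_mode s i" "Q \<notin> large_noise_mode s i j"
        using Q by (auto simp: small large a_def)
      ultimately show "Q \<in> between_modes s i j"
        unfolding between_modes_def by blast
    qed (auto simp: between_modes_def small large a_def)
    have bA: "bounded ?A" using bounded by (simp add: bounded_translation_minus)
    obtain U where U: "open U" "s j \<in> U" "U \<subseteq> voronoi s j"
      using open_subset_voronoi[OF distinct_points] .
    have pos: "0 < (deriv ^^ 2) F Q"
      if "0 < Q" "\<And>x. x \<in> ?A \<Longrightarrow> 0 \<le> curvature_poly (real CARD('n)) Q ((norm x)\<^sup>2)" for Q
      unfolding F_def
    proof (rule deriv2_noise_mass_pos[OF A bA _ _ _ that])
      show "open ((\<lambda>r. r - s i) ` U)" using U(1) by (rule open_translation_subtract)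
    qed (use U in auto)
    have pos_a: "0 < (deriv ^^ 2) F a"
      using a by (intro pos curvature_nonneg_small_noise[OF distinct_points ij]) (auto simp: small a_def)
    have pos_c: "0 < (deriv ^^ 2) F c"
      using a ac by (intro pos curvature_nonneg_large_noise) (auto simp: large)
    \<comment> \<open>The parity lemma counts zeros on the closed interval; strict positivity at
      \<open>a\<close> and \<open>c\<close> ensures that the end points add none.\<close>
    have zeros: "inflection_points F (between_modes s i j) = {x \<in> {a..c}. (deriv ^^ 2) F x = 0}"
      using pos_a pos_c by (auto simp: inflection_points_def between less_le)
    obtain H where H: "H holomorphic_on {z. 0 < Re z}" "\<And>P. 0 < P \<Longrightarrow> H (of_real P) = of_real (F P)"
      unfolding F_def using noise_mass_holomorphic_extension[OF A bA] by blast
    have S: "open {z. 0 < Re z}" "connected {z. 0 < Re z}"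
      by (auto intro: open_halfspace_Re_gt convex_connected convex_halfspace_Re_gt)
    have ext: "(deriv ^^ 2) H (of_real x) = of_real ((deriv ^^ 2) F x)" if "x \<in> {0<..}" for x
      by (rule higher_deriv_holomorphic_extension[OF H(1) S(1) open_greaterThan _ _ that])
        (use H(2) in auto)
    \<comment> \<open>The multiplicity of an inflection point is the vanishing order of the second
      derivative, so the parity lemma is applied to that function, with the second derivative of
      \<open>H\<close> as its extension.\<close>
    have mult: "inflection_multiplicity F = (\<lambda>x. LEAST m. (deriv ^^ m) ((deriv ^^ 2) F) x \<noteq> 0)"
      by (rule HOL.ext) (simp only: inflection_multiplicity_def add.commute[of 2] funpow_add o_apply)
    have image: "of_real ` {0<..} \<subseteq> {z. 0 < Re z}" by auto
    have sub: "a \<le> c" "{a..c} \<subseteq> {0<..}" using a ac by auto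
    have "0 < (deriv ^^ 2) F a * (deriv ^^ 2) F c" using pos_a pos_c by simp
    from even_sum_vanishing_order[OF holomorphic_higher_deriv[OF H(1) S(1)] S open_greaterThan image
        ext sub this]
    show ?thesis unfolding zeros mult by blast
  qed (simp add: inflection_points_def)
  ultimately show ?thesis unfolding F by blast
qed

end
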